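(* Let $A\subset\mathbb{R}$ be Lebesgue measurable and let $\gamma$ be a modulus function satisfying Condition (A). Then $\mathcal{D}_\gamma(A)=\Phi(A)$. Consequently, $|A\,\Delta\,\mathcal{D}_\gamma(A)|=0$.
   Context: $|\cdot|$ denotes Lebesgue measure on $\mathbb{R}$, $A^c=\mathbb{R}\setminus A$, and $\Delta$ is symmetric difference. A modulus function is a function $\gamma:[0,\infty)\to[0,\infty)$ such that (i) $\gamma(a)=0\Leftrightarrow a=0$; (ii) $\gamma(a+b)\le\gamma(a)+\gamma(b)$ for all $a,b\ge 0$; (iii) $\gamma$ is right-continuous at $0$; (iv) $\gamma$ is increasing (in the weak sense: $a\le b$ implies $\gamma(a)\le\gamma(b)$). Condition (A): for every $\varepsilon>0$ there exist $c_\varepsilon\in(0,1)$ and $\delta_\varepsilon>0$ such that $\frac{\gamma(c_\varepsilon t)}{\gamma(t)}<\varepsilon$ for all $0<t<\delta_\varepsilon$. For a Lebesgue measurable $A\subset\mathbb{R}$, $\mathcal{D}_\gamma(A)$ is the set of $\gamma$-density points of $A$, i.e. of all $x\in\mathbb{R}$ with $\lim_{\alpha\to 0^+}\frac{\gamma(|(x-\alpha,x+\alpha)\cap A^c|)}{\gamma(2\alpha)}=0$, and $\Phi(A)$ is the set of Lebesgue density points of $A$, i.e. of all $x\in\mathbb{R}$ with $\lim_{\alpha\to 0^+}\frac{|A\cap(x-\alpha,x+\alpha)|}{2\alpha}=1$. *)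

theory Defs
  imports "HOL-Analysis.Analysis"
begin

(* A function on [0, \<infinity>) is represented by a total function on the reals that is
   constrained, and applied, only on {0..}. *)
definition modulus_function :: "(real \<Rightarrow> real) \<Rightarrow> bool" where
  "modulus_function \<gamma> \<longleftrightarrow>
     \<gamma> \<in> {0..} \<rightarrow> {0..} \<and>
     (\<forall>a\<ge>0. \<gamma> a = 0 \<longleftrightarrow> a = 0) \<and>
     (\<forall>a\<ge>0. \<forall>b\<ge>0. \<gamma> (a + b) \<le> \<gamma> a + \<gamma> b) \<and>
     continuous (at_right 0) \<gamma> \<and>
     mono_on {0..} \<gamma>"

definition condition_A :: "(real \<Rightarrow> real) \<Rightarrow> bool" where
  "condition_A \<gamma> \<longleftrightarrow>
     (\<forall>\<epsilon>>0. \<exists>c\<in>{0<..<1}. \<exists>\<delta>>0. \<forall>t. 0 < t \<and> t < \<delta> \<longrightarrow> \<gamma> (c * t) / \<gamma> t < \<epsilon>)"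

definition gamma_density_points :: "(real \<Rightarrow> real) \<Rightarrow> real set \<Rightarrow> real set" where
  "gamma_density_points \<gamma> A =
     {x. ((\<lambda>\<alpha>. \<gamma> (measure lebesgue ({x - \<alpha><..<x + \<alpha>} \<inter> - A)) / \<gamma> (2 * \<alpha>)) \<longlongrightarrow> 0) (at_right 0)}"

definition lebesgue_density_points :: "real set \<Rightarrow> real set" where
  "lebesgue_density_points A =
     {x. ((\<lambda>\<alpha>. measure lebesgue (A \<inter> {x - \<alpha><..<x + \<alpha>}) / (2 * \<alpha>)) \<longlongrightarrow> 1) (at_right 0)}"

end

theory Submission
  imports Defs
begin

text \<open>
  At a fixed point \<open>x\<close> put \<open>m \<alpha> = measure lebesgue ({x - \<alpha><..<x + \<alpha>} \<inter> - A)\<close>; then \<open>x\<close> is a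
  Lebesgue density point when \<open>m \<alpha> / (2 * \<alpha>)\<close> tends to \<open>0\<close>, and a \<open>\<gamma>\<close>-density point when
  \<open>\<gamma> (m \<alpha>) / \<gamma> (2 * \<alpha>)\<close> does. The two conditions are equivalent because
  \<open>m \<alpha>\<close> is nonnegative while \<open>2 * \<alpha>\<close> is positive and tends to \<open>0\<close>
  (\<open>modulus_ratio_tendsto_0_iff\<close>). Subadditivity gives
  \<open>\<gamma> t \<le> n * \<gamma> (t / n)\<close>, so, \<open>\<gamma>\<close> being increasing, the \<open>\<gamma>\<close>-ratio is at least \<open>1 / n\<close> whenever the ordinary ratio is;
  Condition (A) says that a small ordinary ratio forces a small \<open>\<gamma>\<close>-ratio
  at small \<open>\<alpha>\<close>.

  What remains is Lebesgue's density theorem, \<open>lebesgue_density_theorem\<close>. By the Vitali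
  covering theorem, the points of \<open>A\<close> around which the complement of \<open>A\<close> fills at least a
  proportion \<open>e\<close> of arbitrarily small balls are almost covered by disjoint such balls, inside an open
  set \<open>T\<close> that exceeds \<open>A\<close> by a set of measure less than \<open>\<eta>\<close>. These balls then have total measure at
  most \<open>\<eta> / e\<close>, which can be made as small as desired. Applied to \<open>A\<close> and to its complement, this
  shows that almost every point of \<open>A\<close> has density \<open>1\<close> and almost every other point density \<open>0\<close>.
\<close>

section \<open>Ratios under a modulus function\<close>

lemma modulus_function_le_of_nat_mult:
  assumes "modulus_function \<gamma>" "0 \<le> t"
  shows "\<gamma> (of_nat n * t) \<le> of_nat n * \<gamma> t"
proof (induction n)
  case 0
  have "\<gamma> 0 = 0" using assms by (simp add: modulus_function_def)
  then show ?case by simp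
next
  case (Suc n)
  have "\<gamma> (of_nat (Suc n) * t) = \<gamma> (of_nat n * t + t)"
    by (simp add: algebra_simps)
  also have "\<dots> \<le> \<gamma> (of_nat n * t) + \<gamma> t"
    using assms by (simp add: modulus_function_def)
  finally show ?case using Suc.IH by (simp add: algebra_simps)
qed

lemma modulus_function_pos:
  assumes "modulus_function \<gamma>" "0 < t"
  shows "0 < \<gamma> t"
proof -
  have "0 \<le> \<gamma> t" using assms by (auto simp: modulus_function_def Pi_iff)
  moreover have "\<gamma> t \<noteq> 0" using assms by (auto simp: modulus_function_def)
  ultimately show ?thesis by simp
qed

lemma modulus_function_nonneg:
  assumes "modulus_function \<gamma>" "0 \<le> t"
  shows "0 \<le> \<gamma> t"
  using assms by (auto simp: modulus_function_def Pi_iff)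

lemma modulus_function_mono:
  assumes "modulus_function \<gamma>" "0 \<le> s" "s \<le> t"
  shows "\<gamma> s \<le> \<gamma> t"
  using assms by (auto simp: modulus_function_def monotone_on_def)

text \<open>
  Subadditivity and monotonicity give this direction: if \<open>f x\<close> were at least \<open>g x / n\<close>, then
  \<open>\<gamma> (g x) \<le> n * \<gamma> (g x / n) \<le> n * \<gamma> (f x)\<close>, so the \<open>\<gamma>\<close>-ratio would be at least \<open>1 / n\<close>.
\<close>

lemma modulus_ratio_tendsto_0_imp:
  assumes mod: "modulus_function \<gamma>"
    and f: "\<forall>\<^sub>F x in F. 0 \<le> f x" and g: "\<forall>\<^sub>F x in F. 0 < g x"
    and lim: "((\<lambda>x. \<gamma> (f x) / \<gamma> (g x)) \<longlongrightarrow> 0) F"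
  shows "((\<lambda>x. f x / g x) \<longlongrightarrow> 0) F"
proof (rule tendstoI)
  fix e :: real assume "0 < e"
  then obtain n :: nat where n: "0 < n" "1 / of_nat n < e"
    by (metis nat_approx_posE zero_less_Suc)
  have "\<forall>\<^sub>F x in F. \<gamma> (f x) / \<gamma> (g x) < 1 / n"
    using n by (intro order_tendstoD(2)[OF lim]) auto
  with f g show "\<forall>\<^sub>F x in F. dist (f x / g x) 0 < e"
  proof eventually_elim
    case (elim x)
    have "f x < g x / n"
    proof (rule ccontr)
      assume "\<not> f x < g x / n"
      then have le: "\<gamma> (g x / n) \<le> \<gamma> (f x)"
        using elim by (intro modulus_function_mono[OF mod]) auto
      have "\<gamma> (g x) \<le> n * \<gamma> (g x / n)"
        using modulus_function_le_of_nat_mult[OF mod, of "g x / n" n] elim n by simp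
      also have "\<dots> \<le> n * \<gamma> (f x)" using le by (simp add: mult_left_mono)
      finally show False
        using elim(3) modulus_function_pos[OF mod elim(2)] n
        by (simp add: field_simps)
    qed
    then have "f x / g x < 1 / n" using elim n by (simp add: field_simps)
    then show ?case using elim n by simp
  qed
qed

text \<open>
  Once \<open>f x\<close> is below \<open>c * g x\<close>, monotonicity bounds the \<open>\<gamma>\<close>-ratio by \<open>\<gamma> (c * t) / \<gamma> t\<close> at
  \<open>t = g x\<close>. Condition (A) controls this quotient for small \<open>t\<close> only, which is why \<open>g\<close> has to tend
  to \<open>0\<close>.
\<close>

lemma ratio_tendsto_0_imp_modulus:
  assumes mod: "modulus_function \<gamma>" and A: "condition_A \<gamma>"
    and f: "\<forall>\<^sub>F x in F. 0 \<le> f x" and g: "\<forall>\<^sub>F x in F. 0 < g x" and g0: "(g \<longlongrightarrow> 0) F"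
    and lim: "((\<lambda>x. f x / g x) \<longlongrightarrow> 0) F"
  shows "((\<lambda>x. \<gamma> (f x) / \<gamma> (g x)) \<longlongrightarrow> 0) F"
proof (rule tendstoI)
  fix e :: real assume "0 < e"
  then obtain c d where c: "0 < c" "c < 1" and "0 < d"
    and cd: "\<And>t. 0 < t \<Longrightarrow> t < d \<Longrightarrow> \<gamma> (c * t) / \<gamma> t < e"
    using A unfolding condition_A_def by (metis greaterThanLessThan_iff)
  have "\<forall>\<^sub>F x in F. f x / g x < c" "\<forall>\<^sub>F x in F. g x < d"
    using c \<open>0 < d\<close> by (auto intro: order_tendstoD(2)[OF lim] order_tendstoD(2)[OF g0])
  with f g show "\<forall>\<^sub>F x in F. dist (\<gamma> (f x) / \<gamma> (g x)) 0 < e"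
  proof eventually_elim
    case (elim x)
    have "\<gamma> (f x) \<le> \<gamma> (c * g x)"
      using elim by (intro modulus_function_mono[OF mod]) (auto simp: field_simps)
    then have "\<gamma> (f x) / \<gamma> (g x) \<le> \<gamma> (c * g x) / \<gamma> (g x)"
      using modulus_function_pos[OF mod elim(2)] by (simp add: divide_right_mono)
    also have "\<dots> < e" using elim by (intro cd) auto
    finally show ?case
      using modulus_function_pos[OF mod elim(2)] modulus_function_nonneg[OF mod elim(1)] by simp
  qed
qed

lemma modulus_ratio_tendsto_0_iff:
  assumes "modulus_function \<gamma>" "condition_A \<gamma>"
    and "\<forall>\<^sub>F x in F. 0 \<le> f x" "\<forall>\<^sub>F x in F. 0 < g x" "(g \<longlongrightarrow> 0) F"
  shows "((\<lambda>x. \<gamma> (f x) / \<gamma> (g x)) \<longlongrightarrow> 0) F \<longleftrightarrow> ((\<lambda>x. f x / g x) \<longlongrightarrow> 0) F"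
  using modulus_ratio_tendsto_0_imp[OF assms(1,3,4)] ratio_tendsto_0_imp_modulus[OF assms] by blast

section \<open>The Lebesgue density theorem\<close>

text \<open>
  Disjoint balls chosen by the Vitali theorem inside an open \<open>T \<supseteq> A\<close> have parts outside \<open>A\<close> that are
  disjoint subsets of \<open>T - A\<close>, a set of arbitrarily small measure; each ball is at most \<open>1 / e\<close> times as large as its part outside \<open>A\<close>.
\<close>

lemma negligible_positive_density_of_complement:
  fixes A :: "'a::euclidean_space set"
  assumes A: "A \<in> sets lebesgue" and "0 < e"
  shows "negligible {x \<in> A. \<forall>d>0. \<exists>r. 0 < r \<and> r < d \<and>
    e * measure lebesgue (ball x r) \<le> measure lebesgue (ball x r \<inter> - A)}"
    (is "negligible ?E")
proof (rule iffD2[OF negligible_outer_le], intro allI impI)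
  fix k :: real assume "0 < k"
  obtain T where T: "open T" "A \<subseteq> T" "T - A \<in> lmeasurable"
    and small: "emeasure lebesgue (T - A) < ennreal (k * e)"
    using sets_lebesgue_outer_open[OF A, of "k * e"] \<open>0 < k\<close> \<open>0 < e\<close> by force
  \<comment> \<open>A centre and a radius form one index, because the Vitali theorem covers by an indexed family.\<close>
  define K where "K = {(x, r). 0 < r \<and> ball x r \<subseteq> T \<and>
    e * measure lebesgue (ball x r) \<le> measure lebesgue (ball x r \<inter> - A)}"
  have cover: "\<exists>i. i \<in> K \<and> x \<in> ball (fst i) (snd i) \<and> snd i < d" if x: "x \<in> ?E" and d: "0 < d" for x d
  proof -
    have "x \<in> T" using x T(2) by auto
    then obtain d' where d': "0 < d'" "ball x d' \<subseteq> T"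
      using T(1) open_contains_ball by blast
    have "0 < min d d'" using d d'(1) by simp
    then obtain r where "0 < r" "r < min d d'"
      "e * measure lebesgue (ball x r) \<le> measure lebesgue (ball x r \<inter> - A)"
      using x by blast
    moreover have "ball x r \<subseteq> T"
      using d'(2) \<open>r < min d d'\<close> by (meson less_imp_le min_less_iff_conj order_trans subset_ball)
    ultimately have "(x, r) \<in> K" unfolding K_def by simp
    with \<open>0 < r\<close> \<open>r < min d d'\<close> show ?thesis
      by (intro exI[of _ "(x, r)"]) simp
  qed
  obtain C where C: "countable C" "C \<subseteq> K"
    and disj: "pairwise (\<lambda>i j. disjnt (ball (fst i) (snd i)) (ball (fst j) (snd j))) C"
    and neg: "negligible (?E - (\<Union>i\<in>C. ball (fst i) (snd i)))"
    by (rule Vitali_covering_theorem_balls[where a = fst and r = snd, OF cover])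
  define B where "B = (\<Union>i\<in>C. ball (fst i) (snd i))"
  have bound: "measure lebesgue (\<Union>i\<in>F. ball (fst i) (snd i)) \<le> k" if F: "F \<subseteq> C" "finite F" for F
  proof -
    have in_K: "ball (fst i) (snd i) \<subseteq> T"
      "e * measure lebesgue (ball (fst i) (snd i)) \<le> measure lebesgue (ball (fst i) (snd i) \<inter> - A)"
      if "i \<in> F" for i
    proof -
      have "(fst i, snd i) \<in> K" using that F(1) C(2) by auto
      then show "ball (fst i) (snd i) \<subseteq> T"
        "e * measure lebesgue (ball (fst i) (snd i)) \<le> measure lebesgue (ball (fst i) (snd i) \<inter> - A)"
        unfolding K_def by blast+
    qed
    have meas: "ball (fst i) (snd i) \<inter> - A \<in> lmeasurable" for i :: "'a \<times> real"
      using A by (intro fmeasurable_Int_fmeasurable) (auto simp: Compl_in_sets_lebesgue)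
    have "disjoint_family_on (\<lambda>i. ball (fst i) (snd i) \<inter> - A) F"
      unfolding disjoint_family_on_def
    proof (intro ballI impI)
      fix i j assume "i \<in> F" "j \<in> F" "i \<noteq> j"
      then have "disjnt (ball (fst i) (snd i)) (ball (fst j) (snd j))"
        using F(1) by (intro pairwiseD[OF disj]) auto
      then show "ball (fst i) (snd i) \<inter> - A \<inter> (ball (fst j) (snd j) \<inter> - A) = {}"
        unfolding disjnt_def by blast
    qed
    then have sum_eq: "(\<Sum>i\<in>F. measure lebesgue (ball (fst i) (snd i) \<inter> - A)) =
        measure lebesgue (\<Union>i\<in>F. ball (fst i) (snd i) \<inter> - A)"
      using F(2) fmeasurableD[OF meas] fmeasurableD2[OF meas]
      by (intro measure_finite_Union[symmetric]) (auto simp only: infinity_ennreal_def)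
    have "measure lebesgue (\<Union>i\<in>F. ball (fst i) (snd i)) \<le> (\<Sum>i\<in>F. measure lebesgue (ball (fst i) (snd i)))"
      using F(2) by (intro measure_UNION_le) auto
    then have "e * measure lebesgue (\<Union>i\<in>F. ball (fst i) (snd i)) \<le> (\<Sum>i\<in>F. e * measure lebesgue (ball (fst i) (snd i)))"
      using \<open>0 < e\<close> by (simp add: sum_distrib_left[symmetric])
    also have "\<dots> \<le> (\<Sum>i\<in>F. measure lebesgue (ball (fst i) (snd i) \<inter> - A))"
      using in_K by (intro sum_mono) blast
    also have "\<dots> \<le> measure lebesgue (T - A)"
      unfolding sum_eq
    proof (rule measure_mono_fmeasurable[OF _ _ T(3)])
      show "(\<Union>i\<in>F. ball (fst i) (snd i) \<inter> - A) \<subseteq> T - A"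
        using in_K by blast
      show "(\<Union>i\<in>F. ball (fst i) (snd i) \<inter> - A) \<in> sets lebesgue"
        using F(2) fmeasurableD[OF meas] by (intro sets.finite_UN) auto
    qed
    also have "\<dots> \<le> k * e"
      using small T(3) \<open>0 < k\<close> \<open>0 < e\<close>
      by (simp add: emeasure_eq_measure2 ennreal_less_iff)
    finally show ?thesis using \<open>0 < e\<close> by (simp add: mult.commute)
  qed
  have ball: "ball (fst i) (snd i) \<in> lmeasurable" for i :: "'a \<times> real"
    by (rule lmeasurable_ball)
  have B: "B \<in> lmeasurable" "measure lebesgue B \<le> k"
    unfolding B_def
    by (rule fmeasurable_UN_bound[OF C(1) ball bound] measure_UN_bound[OF C(1) ball bound]; assumption)+
  have N: "?E - B \<in> null_sets lebesgue"
    using neg unfolding B_def negligible_iff_null_sets .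
  have "?E \<subseteq> B \<union> (?E - B)" by blast
  moreover have "B \<union> (?E - B) \<in> lmeasurable"
    by (rule fmeasurable.Un[OF B(1) fmeasurableI_null_sets[OF N]])
  moreover have "measure lebesgue (B \<union> (?E - B)) \<le> k"
    unfolding measure_Un_null_set[OF fmeasurableD[OF B(1)] N] by (rule B(2))
  ultimately show "\<exists>T. ?E \<subseteq> T \<and> T \<in> lmeasurable \<and> measure lebesgue T \<le> k"
    by (intro exI[of _ "B \<union> (?E - B)"] conjI)
qed

text \<open>
  Failure of convergence to \<open>0\<close> means that the proportion of the complement is at least some
  \<open>1 / Suc n\<close> at arbitrarily small radii, so the exceptional set is a countable union of sets that the
  previous lemma shows to be negligible.
\<close>

lemma lebesgue_density_theorem:
  fixes A :: "'a::euclidean_space set"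
  assumes A: "A \<in> sets lebesgue"
  shows "negligible {x \<in> A. \<not> ((\<lambda>r. measure lebesgue (ball x r \<inter> - A) / measure lebesgue (ball x r)) \<longlongrightarrow> 0) (at_right 0)}"
    (is "negligible ?E")
proof -
  define E where "E e = {x \<in> A. \<forall>d>0. \<exists>r. 0 < r \<and> r < d \<and>
    e * measure lebesgue (ball x r) \<le> measure lebesgue (ball x r \<inter> - A)}" for e :: real
  have "?E \<subseteq> (\<Union>n. E (1 / Suc n))"
  proof (rule subsetI, rule ccontr)
    fix x assume x: "x \<in> ?E" "x \<notin> (\<Union>n. E (1 / Suc n))"
    have "((\<lambda>r. measure lebesgue (ball x r \<inter> - A) / measure lebesgue (ball x r)) \<longlongrightarrow> 0) (at_right 0)"
    proof (rule tendstoI)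
      fix e :: real assume "0 < e"
      then obtain n where n: "1 / Suc n < e"
        by (metis nat_approx_posE)
      have "x \<in> A" "x \<notin> E (1 / Suc n)" using x by auto
      then obtain d where d: "0 < d"
        "\<And>r. 0 < r \<Longrightarrow> r < d \<Longrightarrow> measure lebesgue (ball x r \<inter> - A) < 1 / Suc n * measure lebesgue (ball x r)"
        unfolding E_def by (auto simp: not_le)
      have "\<forall>\<^sub>F r in at_right 0. 0 < r \<and> r < d"
        using d(1) unfolding eventually_at_right_field by auto
      then show "\<forall>\<^sub>F r in at_right 0. dist (measure lebesgue (ball x r \<inter> - A) / measure lebesgue (ball x r)) 0 < e"
      proof eventually_elim
        case (elim r)
        have pos: "0 < measure lebesgue (ball x r)"
          using elim by (simp add: content_ball_pos)
        then have "measure lebesgue (ball x r \<inter> - A) / measure lebesgue (ball x r) < 1 / Suc n"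
          using d(2)[of r] elim by (simp only: pos_divide_less_eq)
        then show ?case using n pos by simp
      qed
    qed
    with x(1) show False by simp
  qed
  moreover have "negligible (\<Union>n. E (1 / Suc n))"
    unfolding E_def by (intro negligible_Union_nat negligible_positive_density_of_complement[OF A]) auto
  ultimately show ?thesis by (rule negligible_subset[rotated])
qed

section \<open>Density points on the line\<close>

lemma measure_interval_Int_add_measure_interval_Int_Compl:
  fixes A :: "real set"
  assumes "A \<in> sets lebesgue" "0 \<le> r"
  shows "measure lebesgue (A \<inter> {x - r<..<x + r}) + measure lebesgue ({x - r<..<x + r} \<inter> - A) = 2 * r"
proof -
  let ?I = "{x - r<..<x + r}"
  have I: "?I \<in> lmeasurable" by (metis box_real(1) lmeasurable_box)
  have m: "A \<inter> ?I \<in> lmeasurable" "?I \<inter> - A \<in> lmeasurable"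
    using I assms(1) by (auto intro!: fmeasurable_Int_fmeasurable simp: Compl_in_sets_lebesgue
        Int_commute[of A])
  have "measure lebesgue ((A \<inter> ?I) \<union> (?I \<inter> - A)) =
      measure lebesgue (A \<inter> ?I) + measure lebesgue (?I \<inter> - A)"
    using m by (intro measure_Un2[THEN trans]) (auto intro!: arg_cong[where f = "measure lebesgue"])
  moreover have "(A \<inter> ?I) \<union> (?I \<inter> - A) = ?I" by blast
  moreover have "measure lebesgue ?I = 2 * r"
    using assms(2) by (simp add: measure_completion)
  ultimately show ?thesis by simp
qed

text \<open>
  This form puts the Lebesgue condition on the same set as the \<open>\<gamma>\<close>-density condition, so that the
  two differ only by the application of \<open>\<gamma>\<close>.
\<close>

lemma lebesgue_density_points_iff_complement:
  assumes "A \<in> sets lebesgue"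
  shows "x \<in> lebesgue_density_points A \<longleftrightarrow>
    ((\<lambda>r. measure lebesgue ({x - r<..<x + r} \<inter> - A) / (2 * r)) \<longlongrightarrow> 0) (at_right 0)"
proof -
  let ?f = "\<lambda>r. measure lebesgue (A \<inter> {x - r<..<x + r}) / (2 * r)"
  let ?g = "\<lambda>r. measure lebesgue ({x - r<..<x + r} \<inter> - A) / (2 * r)"
  have "\<forall>\<^sub>F r::real in at_right 0. 0 < r"
    by (auto simp: eventually_at_right_field intro: exI[of _ 1])
  then have "\<forall>\<^sub>F r in at_right 0. ?f r - 1 = - ?g r"
  proof eventually_elim
    case (elim r)
    then have "?f r + ?g r = 1"
      using measure_interval_Int_add_measure_interval_Int_Compl[OF assms, of r x]
      by (simp add: add_divide_distrib[symmetric])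
    then show ?case by simp
  qed
  then have "((\<lambda>r. ?f r - 1) \<longlongrightarrow> 0) (at_right 0) \<longleftrightarrow> ((\<lambda>r. - ?g r) \<longlongrightarrow> 0) (at_right 0)"
    by (rule tendsto_cong)
  then show ?thesis
    unfolding lebesgue_density_points_def mem_Collect_eq
    using tendsto_minus_cancel_left[of ?g 0 "at_right 0"] LIM_zero_iff[of ?f 1 "at_right 0"] by simp
qed

theorem theorem4:
  fixes A :: "real set" and \<gamma> :: "real \<Rightarrow> real"
  assumes "A \<in> sets lebesgue"
    and "modulus_function \<gamma>"
    and "condition_A \<gamma>"
  shows "gamma_density_points \<gamma> A = lebesgue_density_points A
    \<and> sym_diff A (gamma_density_points \<gamma> A) \<in> null_sets lebesgue"
proof -
  have "x \<in> gamma_density_points \<gamma> A \<longleftrightarrow> x \<in> lebesgue_density_points A" for x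
  proof -
    have "\<forall>\<^sub>F r in at_right 0. 0 < 2 * (r::real)"
      by (auto simp: eventually_at_right_field intro: exI[of _ 1])
    moreover have "((\<lambda>r::real. 2 * r) \<longlongrightarrow> 0) (at_right 0)"
      by (auto intro!: tendsto_eq_intros)
    ultimately show ?thesis
      unfolding gamma_density_points_def lebesgue_density_points_iff_complement[OF assms(1)] mem_Collect_eq
      by (intro modulus_ratio_tendsto_0_iff[OF assms(2,3)]) auto
  qed
  then have eq: "gamma_density_points \<gamma> A = lebesgue_density_points A" by blast
  have ball: "((\<lambda>r. measure lebesgue (ball x r \<inter> S) / measure lebesgue (ball x r)) \<longlongrightarrow> l) (at_right 0) \<longleftrightarrow>
      ((\<lambda>r. measure lebesgue ({x - r<..<x + r} \<inter> S) / (2 * r)) \<longlongrightarrow> l) (at_right 0)" for x l :: real and S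
    by (rule tendsto_cong) (auto simp: eventually_at_right_field ball_eq_greaterThanLessThan intro!: exI[of _ 1])
  have "negligible (A - lebesgue_density_points A)"
    using lebesgue_density_theorem[OF assms(1)] unfolding ball
    by (rule negligible_subset) (auto simp: lebesgue_density_points_iff_complement[OF assms(1)])
  moreover have "negligible (lebesgue_density_points A - A)"
  proof (rule negligible_subset[OF lebesgue_density_theorem[of "- A"]])
    show "- A \<in> sets lebesgue" using assms(1) by (rule Compl_in_sets_lebesgue[THEN iffD2])
    \<comment> \<open>A point outside \<open>A\<close> at which \<open>A\<close> has density \<open>0\<close> cannot also be one at which it has density \<open>1\<close>.\<close>
    show "lebesgue_density_points A - A \<subseteq>
      {x \<in> - A. \<not> ((\<lambda>r. measure lebesgue (ball x r \<inter> - (- A)) / measure lebesgue (ball x r)) \<longlongrightarrow> 0) (at_right 0)}"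
      unfolding ball
    proof clarsimp
      fix x assume "x \<in> lebesgue_density_points A"
        and "((\<lambda>r. measure lebesgue ({x - r<..<x + r} \<inter> A) / (2 * r)) \<longlongrightarrow> 0) (at_right 0)"
      then show False
        using tendsto_unique[of "at_right (0::real)"] unfolding lebesgue_density_points_def
        by (fastforce simp: Int_commute)
    qed
  qed
  ultimately have "negligible (sym_diff A (lebesgue_density_points A))"
    by (rule negligible_Un)
  then show ?thesis
    unfolding eq negligible_iff_null_sets by simp
qed

end
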